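(* Let $\mathcal{S}$ be a distributed schema and let $Q$ be a minimal Boolean conjunctive query over $\mathcal{S}$. If a CQ-based d-view $\mathcal{V}$ determines $Q$, then for every source $s$, $\mathcal{V}$ determines the canonical view $\mathrm{CanV}^s(Q)$.
   Context: A distributed schema (d-schema) consists of a finite set of sources, each source $s$ having a local schema $\mathcal{S}_s$ (a finite set of relation names with arities); local schemas are pairwise disjoint. A d-instance is an instance of the union of the local schemas (relations may be finite or infinite); $\mathcal{D}_s$ denotes its restriction to $\mathcal{S}_s$. A d-view $\mathcal{V}$ assigns to each source $s$ a finite set $\mathcal{V}_s$ of views, each view being a query over $\mathcal{S}_s$ only; it is CQ-based if every view is defined by a conjunctive query (CQ). Two d-instances are $\mathcal{V}$-indistinguishable if every view of $\mathcal{V}$ has the same output on them. $\mathcal{V}$ determines a query $Q$ if for all $\mathcal{V}$-indistinguishable d-instances $\mathcal{D},\mathcal{D}'$ (finite or infinite) we have $Q(\mathcal{D})=Q(\mathcal{D}')$. Queries are Boolean CQs without constants. A CQ $Q_0$ is a subquery of $Q$ if its atoms are a subset of those of $Q$ (with the same free variables); $Q$ is minimal if there is no homomorphism from $Q$ to a strict subquery of $Q$. For a CQ $Q$ and source $s$, $\mathrm{SVars}(s,Q)$ is the set of variables of $Q$ occurring in an atom over $\mathcal{S}_s$, and $\mathrm{SJVars}(s,Q)$ is the set of those variables of $\mathrm{SVars}(s,Q)$ that also occur in an atom of another source. The canonical view $\mathrm{CanV}^s(Q)$ is the CQ formed by conjoining all atoms of $Q$ over $\mathcal{S}_s$ and existentially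 quantifying the bound variables of $Q$ in $\mathrm{SVars}(s,Q)\setminus\mathrm{SJVars}(s,Q)$ (so for Boolean $Q$ its free variables are $\mathrm{SJVars}(s,Q)$). *)

theory Defs
  imports Main "HOL-Library.Disjoint_Sets"
begin

record ('s, 'r) dschema =
  sources :: "'s set"
  rels :: "'s \<Rightarrow> 'r set"
  arity :: "'r \<Rightarrow> nat"

definition d_schema :: "('s, 'r) dschema \<Rightarrow> bool" where
  "d_schema S \<longleftrightarrow>
     finite (sources S) \<and>
     (\<forall>s\<in>sources S. finite (rels S s)) \<and>
     disjoint_family_on (rels S) (sources S)"

definition all_rels :: "('s, 'r) dschema \<Rightarrow> 'r set" where
  "all_rels S = (\<Union>s\<in>sources S. rels S s)"

text \<open>Relations are sets of tuples over the universe of values \<open>'c\<close>; they may be infinite.\<close>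

type_synonym ('r, 'c) inst = "'r \<Rightarrow> 'c list set"

definition d_instance :: "('s, 'r) dschema \<Rightarrow> ('r, 'c) inst \<Rightarrow> bool" where
  "d_instance S D \<longleftrightarrow> (\<forall>r. \<forall>t\<in>D r. r \<in> all_rels S \<and> length t = arity S r)"

definition local_inst :: "('s, 'r) dschema \<Rightarrow> 's \<Rightarrow> ('r, 'c) inst \<Rightarrow> ('r, 'c) inst" where
  "local_inst S s D = (\<lambda>r. if r \<in> rels S s then D r else {})"

text \<open>A query maps instances to relations; a Boolean query has output \<open>{[]}\<close> (true)
  or \<open>{}\<close> (false).\<close>

type_synonym ('r, 'c) query = "('r, 'c) inst \<Rightarrow> 'c list set"

definition local_query :: "('s, 'r) dschema \<Rightarrow> 's \<Rightarrow> ('r, 'c) query \<Rightarrow> bool" where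
  "local_query S s q \<longleftrightarrow>
     (\<exists>n. \<forall>D. d_instance S D \<longrightarrow> (\<forall>t\<in>q D. length t = n)) \<and>
     (\<forall>D. d_instance S D \<longrightarrow> q D = q (local_inst S s D))"

type_synonym ('s, 'r, 'c) dview = "'s \<Rightarrow> ('r, 'c) query set"

definition d_view :: "('s, 'r) dschema \<Rightarrow> ('s, 'r, 'c) dview \<Rightarrow> bool" where
  "d_view S V \<longleftrightarrow> (\<forall>s\<in>sources S. finite (V s) \<and> (\<forall>v\<in>V s. local_query S s v))"

definition indistinguishable ::
    "('s, 'r) dschema \<Rightarrow> ('s, 'r, 'c) dview \<Rightarrow> ('r, 'c) inst \<Rightarrow> ('r, 'c) inst \<Rightarrow> bool" where
  "indistinguishable S V D D' \<longleftrightarrow> (\<forall>s\<in>sources S. \<forall>v\<in>V s. v D = v D')"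

definition determines ::
    "('s, 'r) dschema \<Rightarrow> ('s, 'r, 'c) dview \<Rightarrow> ('r, 'c) query \<Rightarrow> bool" where
  "determines S V q \<longleftrightarrow>
     (\<forall>D D'. d_instance S D \<longrightarrow> d_instance S D' \<longrightarrow> indistinguishable S V D D' \<longrightarrow> q D = q D')"

type_synonym var = nat

datatype 'r atom = Atom (rel: 'r) (args: "var list")

text \<open>Conjunctive queries have no constants. The list \<open>head\<close> is the tuple of free variables;
  all other variables of \<open>body\<close> are existentially quantified.\<close>

record 'r cq =
  head :: "var list"
  body :: "'r atom set"

definition vars :: "'r cq \<Rightarrow> var set" where
  "vars Q = (\<Union>a\<in>body Q. set (args a))"

definition free_vars :: "'r cq \<Rightarrow> var set" where
  "free_vars Q = set (head Q)"

definition bound_vars :: "'r cq \<Rightarrow> var set" where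
  "bound_vars Q = vars Q - free_vars Q"

definition boolean_cq :: "'r cq \<Rightarrow> bool" where
  "boolean_cq Q \<longleftrightarrow> head Q = []"

definition cq_over :: "('s, 'r) dschema \<Rightarrow> 'r set \<Rightarrow> 'r cq \<Rightarrow> bool" where
  "cq_over S R Q \<longleftrightarrow>
     finite (body Q) \<and>
     (\<forall>a\<in>body Q. rel a \<in> R \<and> length (args a) = arity S (rel a)) \<and>
     free_vars Q \<subseteq> vars Q"

definition cq_eval :: "'r cq \<Rightarrow> ('r, 'c) query" where
  "cq_eval Q D = {map h (head Q) | h. \<forall>a\<in>body Q. map h (args a) \<in> D (rel a)}"

definition cq_based :: "('s, 'r) dschema \<Rightarrow> ('s, 'r, 'c) dview \<Rightarrow> bool" where
  "cq_based S V \<longleftrightarrow>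
     (\<forall>s\<in>sources S. \<forall>v\<in>V s. \<exists>Q. cq_over S (rels S s) Q \<and>
        (\<forall>D. d_instance S D \<longrightarrow> v D = cq_eval Q D))"

definition cq_hom :: "(var \<Rightarrow> var) \<Rightarrow> 'r cq \<Rightarrow> 'r cq \<Rightarrow> bool" where
  "cq_hom h Q Q' \<longleftrightarrow>
     (\<forall>a\<in>body Q. Atom (rel a) (map h (args a)) \<in> body Q') \<and>
     map h (head Q) = head Q'"

definition subquery :: "'r cq \<Rightarrow> 'r cq \<Rightarrow> bool" where
  "subquery Q0 Q \<longleftrightarrow> body Q0 \<subseteq> body Q \<and> head Q0 = head Q"

definition strict_subquery :: "'r cq \<Rightarrow> 'r cq \<Rightarrow> bool" where
  "strict_subquery Q0 Q \<longleftrightarrow> subquery Q0 Q \<and> body Q0 \<noteq> body Q"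

definition minimal_cq :: "'r cq \<Rightarrow> bool" where
  "minimal_cq Q \<longleftrightarrow> \<not> (\<exists>Q0 h. strict_subquery Q0 Q \<and> cq_hom h Q Q0)"

definition source_atoms :: "('s, 'r) dschema \<Rightarrow> 's \<Rightarrow> 'r cq \<Rightarrow> 'r atom set" where
  "source_atoms S s Q = {a \<in> body Q. rel a \<in> rels S s}"

definition SVars :: "('s, 'r) dschema \<Rightarrow> 's \<Rightarrow> 'r cq \<Rightarrow> var set" where
  "SVars S s Q = (\<Union>a\<in>source_atoms S s Q. set (args a))"

definition SJVars :: "('s, 'r) dschema \<Rightarrow> 's \<Rightarrow> 'r cq \<Rightarrow> var set" where
  "SJVars S s Q = {x \<in> SVars S s Q. \<exists>s'\<in>sources S. s' \<noteq> s \<and> x \<in> SVars S s' Q}"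

text \<open>The order of the free variables in the head is immaterial; we take the increasing one.\<close>

definition CanV :: "('s, 'r) dschema \<Rightarrow> 's \<Rightarrow> 'r cq \<Rightarrow> 'r cq" where
  "CanV S s Q =
     \<lparr> head = sorted_list_of_set
         (SVars S s Q - (bound_vars Q \<inter> (SVars S s Q - SJVars S s Q))),
       body = source_atoms S s Q \<rparr>"

lemma free_vars_CanV_boolean:
  assumes "boolean_cq Q" and "finite (body Q)"
  shows "free_vars (CanV S s Q) = SJVars S s Q"
proof -
  have fin: "finite (SVars S s Q)"
    using assms(2) by (auto simp: SVars_def source_atoms_def)
  have "SVars S s Q \<subseteq> bound_vars Q"
    using assms(1)
    by (auto simp: SVars_def source_atoms_def bound_vars_def vars_def free_vars_def boolean_cq_def)
  moreover have "SJVars S s Q \<subseteq> SVars S s Q"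
    by (auto simp: SJVars_def)
  ultimately show ?thesis
    using fin by (auto simp: CanV_def free_vars_def)
qed

end

theory Submission
  imports Defs
begin

text \<open>Given a match \<open>h\<close> of the atoms of \<open>Q\<close> at source \<open>s\<close> in \<open>D\<close>, populate source \<open>s\<close> with the
  direct product of \<open>D\<close> and the canonical instance of \<open>Q\<close>, and all other sources with the copy
  \<open>x \<mapsto> (h x, x)\<close> of \<open>Q\<close>. Conjunctive queries commute with direct products, so replacing \<open>D\<close> by
  an indistinguishable \<open>D'\<close> in the product keeps all views, and hence keeps \<open>Q\<close> true. The second
  component of the resulting match is an endomorphism of \<open>Q\<close>, which is an automorphism by
  minimality. After composing with its inverse, the first component maps the atoms at \<open>s\<close> into
  \<open>D'\<close> and agrees with \<open>h\<close> on the variables shared with other sources.\<close>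

text \<open>Cardinal absorption: an infinite set has the size of its product with
  \<open>nat\<close>. The factor is \<open>nat\<close> because the second components will be
  variables of \<open>Q\<close>.\<close>

lemma infinite_bij_Times_nat:
  assumes "infinite (UNIV :: 'c set)"
  obtains f :: "'c \<Rightarrow> 'c \<times> nat" where "bij f"
proof -
  have "(card_of (UNIV :: nat set), card_of (UNIV :: 'c set)) \<in> ordLeq"
    using assms infinite_iff_card_of_nat by blast
  then have "(card_of ((UNIV :: 'c set) \<times> (UNIV :: nat set)), card_of (UNIV :: 'c set)) \<in> ordIso"
    using card_of_Times_infinite[OF assms] by blast
  then obtain g :: "'c \<times> nat \<Rightarrow> 'c" where "bij g"
    using card_of_ordIso by (metis UNIV_Times_UNIV)
  then show ?thesis
    using that bij_imp_bij_inv by blast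
qed

text \<open>The map \<open>f\<close> identifies the values with pairs, so that the product is again an instance
  over the values \<open>'c\<close>.\<close>

definition prod_inst ::
    "('c \<Rightarrow> 'a \<times> 'b) \<Rightarrow> ('r, 'a) inst \<Rightarrow> ('r, 'b) inst \<Rightarrow> ('r, 'c) inst" where
  "prod_inst f D C = (\<lambda>r. {t. map (fst \<circ> f) t \<in> D r \<and> map (snd \<circ> f) t \<in> C r})"

text \<open>A valuation in a product is a pair of valuations in the factors. Surjectivity of
  \<open>f\<close> codes such a pair as one valuation; injectivity makes its output tuple equal to
  \<open>t\<close>.\<close>

lemma cq_eval_prod_inst:
  assumes "bij f"
  shows "cq_eval q (prod_inst f D C) =
    {t. map (fst \<circ> f) t \<in> cq_eval q D \<and> map (snd \<circ> f) t \<in> cq_eval q C}" (is "?L = ?R")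
proof
  show "?L \<subseteq> ?R"
  proof
    fix t assume "t \<in> ?L"
    then obtain h where h: "t = map h (head q)"
        "\<forall>a\<in>body q. map h (args a) \<in> prod_inst f D C (rel a)"
      by (auto simp: cq_eval_def)
    then have "map (fst \<circ> f) t = map (fst \<circ> f \<circ> h) (head q)"
        "\<forall>a\<in>body q. map (fst \<circ> f \<circ> h) (args a) \<in> D (rel a)"
        "map (snd \<circ> f) t = map (snd \<circ> f \<circ> h) (head q)"
        "\<forall>a\<in>body q. map (snd \<circ> f \<circ> h) (args a) \<in> C (rel a)"
      by (simp_all add: prod_inst_def)
    then show "t \<in> ?R"
      unfolding cq_eval_def by blast
  qed
next
  show "?R \<subseteq> ?L"
  proof
    fix t assume "t \<in> ?R"
    then obtain h i where
      h: "map (fst \<circ> f) t = map h (head q)" "\<forall>a\<in>body q. map h (args a) \<in> D (rel a)" and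
      i: "map (snd \<circ> f) t = map i (head q)" "\<forall>a\<in>body q. map i (args a) \<in> C (rel a)"
      by (auto simp: cq_eval_def)
    define k where "k x = inv f (h x, i x)" for x
    have fk: "f (k x) = (h x, i x)" for x
      using assms by (simp add: k_def bij_is_surj surj_f_inv_f)
    have "t = map k (head q)"
    proof (rule nth_equalityI)
      show len: "length t = length (map k (head q))"
        using h(1) by (metis length_map)
      fix n assume n: "n < length t"
      have "f (t ! n) = f (k (head q ! n))"
        using arg_cong[OF h(1), of "\<lambda>l. l ! n"] arg_cong[OF i(1), of "\<lambda>l. l ! n"] n len
        by (simp add: fk prod_eq_iff)
      then have "t ! n = k (head q ! n)"
        using assms by (simp add: bij_is_inj inj_eq)
      then show "t ! n = map k (head q) ! n"
        using n len by simp
    qed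
    moreover have "\<forall>a\<in>body q. map k (args a) \<in> prod_inst f D C (rel a)"
      using h(2) i(2) by (simp add: prod_inst_def fk comp_def)
    ultimately show "t \<in> ?L"
      by (auto simp: cq_eval_def)
  qed
qed

lemma cq_eval_cong:
  assumes "\<And>a. a \<in> body q \<Longrightarrow> D (rel a) = D' (rel a)"
  shows "cq_eval q D = cq_eval q D'"
  using assms by (simp add: cq_eval_def)

text \<open>By minimality the image of \<open>Q\<close> under \<alpha> contains every atom, so
  \<alpha> maps the finite set of variables onto itself and is therefore a permutation of
  it.\<close>

lemma minimal_cq_endo_inverse:
  assumes "minimal_cq Q" and "cq_over S R Q" and hom: "cq_hom \<alpha> Q Q"
  obtains \<beta> where "cq_hom \<beta> Q Q" and "\<And>x. x \<in> vars Q \<Longrightarrow> \<alpha> (\<beta> x) = x"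
proof -
  define A where "A a = Atom (rel a) (map \<alpha> (args a))" for a :: "'a atom"
  have sub: "A ` body Q \<subseteq> body Q"
    using hom by (auto simp: cq_hom_def A_def)
  have onto: "A ` body Q = body Q"
  proof (rule ccontr)
    assume "A ` body Q \<noteq> body Q"
    then have "strict_subquery (Q\<lparr>body := A ` body Q\<rparr>) Q"
      using sub by (simp add: strict_subquery_def subquery_def)
    moreover have "cq_hom \<alpha> Q (Q\<lparr>body := A ` body Q\<rparr>)"
      using hom by (auto simp: cq_hom_def A_def)
    ultimately show False
      using assms(1) by (auto simp: minimal_cq_def)
  qed
  have fin: "finite (vars Q)" and free: "set (head Q) \<subseteq> vars Q"
    using assms(2) by (simp_all add: vars_def cq_over_def free_vars_def)
  have "vars Q = (\<Union>a\<in>A ` body Q. set (args a))"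
    by (simp add: onto vars_def)
  also have "\<dots> = \<alpha> ` vars Q"
    by (auto simp: vars_def A_def)
  finally have im: "\<alpha> ` vars Q = vars Q" by simp
  then have inj: "inj_on \<alpha> (vars Q)"
    using fin by (simp add: eq_card_imp_inj_on)
  define \<beta> where "\<beta> = inv_into (vars Q) \<alpha>"
  have left: "\<beta> (\<alpha> x) = x" if "x \<in> vars Q" for x
    using inj that by (simp add: \<beta>_def)
  have right: "\<alpha> (\<beta> x) = x" if "x \<in> vars Q" for x
    using im that by (simp add: \<beta>_def f_inv_into_f)
  have "Atom (rel a) (map \<beta> (args a)) \<in> body Q" if a: "a \<in> body Q" for a
  proof -
    \<comment> \<open>Every atom is an image under \<open>A\<close>, so \<beta> sends it back to an
      atom of \<open>Q\<close>.\<close>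
    obtain b where b: "b \<in> body Q" "a = A b"
      using onto a by blast
    have "map \<beta> (map \<alpha> (args b)) = args b"
      using left b(1) map_idI[of "args b" "\<beta> \<circ> \<alpha>"] by (force simp: vars_def)
    then show ?thesis
      using b by (simp add: A_def)
  qed
  moreover have "map \<beta> (head Q) = head Q"
  proof (rule map_idI)
    fix x assume x: "x \<in> set (head Q)"
    have "map \<alpha> (head Q) = head Q"
      using hom by (simp add: cq_hom_def)
    then have "\<alpha> x = x"
      using x map_eq_conv[of \<alpha> "head Q" id] by simp
    then show "\<beta> x = x"
      using left[of x] x free by auto
  qed
  ultimately show ?thesis
    using that[of \<beta>] right by (simp add: cq_hom_def)
qed

text \<open>One inclusion is enough for determinacy, since indistinguishability is
  symmetric.\<close>

lemma cq_eval_CanV_mono: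
  fixes S :: "('s, 'r) dschema"
    and V :: "('s, 'r, 'c) dview"
    and Q :: "'r cq"
    and D D' :: "('r, 'c) inst"
  assumes inf: "infinite (UNIV :: 'c set)"
    and S: "d_schema S"
    and Q: "cq_over S (all_rels S) Q" "boolean_cq Q" "minimal_cq Q"
    and V: "cq_based S V" "determines S V (cq_eval Q)"
    and s: "s \<in> sources S"
    and D: "d_instance S D" "d_instance S D'" "indistinguishable S V D D'"
  shows "cq_eval (CanV S s Q) D \<subseteq> cq_eval (CanV S s Q) D'"
proof
  fix t assume "t \<in> cq_eval (CanV S s Q) D"
  then obtain h where t: "t = map h (head (CanV S s Q))"
    and h: "\<And>a. a \<in> source_atoms S s Q \<Longrightarrow> map h (args a) \<in> D (rel a)"
    by (auto simp: cq_eval_def CanV_def)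
  obtain f :: "'c \<Rightarrow> 'c \<times> nat" where f: "bij f"
    using infinite_bij_Times_nat[OF inf] .
  define g where "g x = inv f (h x, x)" for x
  have fg: "f (g x) = (h x, x)" for x
    using f by (simp add: g_def bij_is_surj surj_f_inv_f)
  define C where "C r = {l. Atom r l \<in> body Q}" for r
  \<comment> \<open>Only the part at \<open>s\<close> depends on the instance argument, so views at
    other sources cannot tell \<open>E D\<close> from \<open>E D'\<close>.\<close>
  define E where "E D r = (if r \<in> rels S s then prod_inst f D C r
      else {map g (args a) | a. a \<in> body Q \<and> rel a = r})" for D r
  have inst: "d_instance S (E D)" if "d_instance S D" for D
  proof -
    have "r \<in> all_rels S \<and> length l = arity S r" if l: "l \<in> E D r" for r l
    proof (cases "r \<in> rels S s")
      case True
      then have "map (fst \<circ> f) l \<in> D r"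
        using l by (simp add: E_def prod_inst_def)
      then show ?thesis
        using \<open>d_instance S D\<close> by (metis d_instance_def length_map)
    next
      case False
      then show ?thesis
        using l Q(1) by (auto simp: E_def cq_over_def)
    qed
    then show ?thesis by (simp add: d_instance_def)
  qed
  have "v (E D) = v (E D')" if s': "s' \<in> sources S" and v: "v \<in> V s'" for s' v
  proof -
    obtain q where q: "cq_over S (rels S s') q"
      and vq: "\<And>D. d_instance S D \<Longrightarrow> v D = cq_eval q D"
      using V(1)[unfolded cq_based_def, rule_format, OF s' v] by auto
    have "cq_eval q (E D) = cq_eval q (E D')"
    proof (cases "s' = s")
      case True
      have E: "cq_eval q (E X) = cq_eval q (prod_inst f X C)" for X
        using q True by (intro cq_eval_cong) (auto simp: E_def cq_over_def)
      have "cq_eval q D = cq_eval q D'"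
        using D s' v by (metis indistinguishable_def vq)
      then show ?thesis
        by (simp add: E cq_eval_prod_inst[OF f])
    next
      case False
      then have "rels S s' \<inter> rels S s = {}"
        using S s s' by (simp add: d_schema_def disjoint_family_on_def)
      then show ?thesis
        using q by (intro cq_eval_cong) (auto simp: E_def cq_over_def)
    qed
    then show ?thesis
      using vq inst D by simp
  qed
  then have "indistinguishable S V (E D) (E D')"
    by (simp add: indistinguishable_def)
  then have "cq_eval Q (E D) = cq_eval Q (E D')"
    using V(2) inst D by (simp add: determines_def)
  moreover have "[] \<in> cq_eval Q (E D)"
  proof -
    \<comment> \<open>At \<open>s\<close> the two components of \<open>g\<close> are the match
      \<open>h\<close> and the identity on variables; elsewhere the tuple is present by
      construction.\<close>
    have "map g (args a) \<in> E D (rel a)" if "a \<in> body Q" for a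
      using that h[of a] by (auto simp: E_def prod_inst_def C_def fg comp_def source_atoms_def)
    then show ?thesis
      using Q(2) by (auto simp: cq_eval_def boolean_cq_def)
  qed
  ultimately have "[] \<in> cq_eval Q (E D')" by simp
  then obtain k where k: "\<And>a. a \<in> body Q \<Longrightarrow> map k (args a) \<in> E D' (rel a)"
    by (auto simp: cq_eval_def)
  have "cq_hom (snd \<circ> f \<circ> k) Q Q"
  proof -
    \<comment> \<open>At \<open>s\<close> the second factor of the product is the canonical
      instance; elsewhere the tuple is a copy of an atom of \<open>Q\<close>, and its second
      components are the variables of that atom.\<close>
    have "Atom (rel a) (map (snd \<circ> f \<circ> k) (args a)) \<in> body Q" if a: "a \<in> body Q" for a
    proof (cases "rel a \<in> rels S s")
      case True
      then show ?thesis
        using k[OF a] by (simp add: E_def prod_inst_def C_def comp_def)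
    next
      case False
      then obtain c where c: "c \<in> body Q" "rel c = rel a" "map k (args a) = map g (args c)"
        using k[OF a] by (auto simp: E_def)
      have "map (snd \<circ> f \<circ> k) (args a) = map (snd \<circ> f) (map g (args c))"
        by (simp flip: c(3))
      then show ?thesis
        using c(1,2) by (cases c) (simp add: fg comp_def)
    qed
    then show ?thesis
      using Q(2) by (simp add: cq_hom_def boolean_cq_def)
  qed
  then obtain \<beta> where \<beta>: "cq_hom \<beta> Q Q"
    and inv: "\<And>x. x \<in> vars Q \<Longrightarrow> (snd \<circ> f \<circ> k) (\<beta> x) = x"
    using minimal_cq_endo_inverse[OF Q(3,1)] by blast
  \<comment> \<open>Precomposing with \<beta> keeps the match and makes its second component the
    identity on the variables of \<open>Q\<close>.\<close>
  have k\<beta>: "map (k \<circ> \<beta>) (args a) \<in> E D' (rel a)" if "a \<in> body Q" for a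
    using k[of "Atom (rel a) (map \<beta> (args a))"] \<beta> that by (simp add: cq_hom_def)
  define j where "j = fst \<circ> f \<circ> k \<circ> \<beta>"
  have "map j (args a) \<in> D' (rel a)" if "a \<in> source_atoms S s Q" for a
    using k\<beta>[of a] that by (simp add: E_def source_atoms_def prod_inst_def j_def comp_assoc)
  moreover have "j x = h x" if x: "x \<in> SJVars S s Q" for x
  proof -
    obtain s' a where s': "s' \<in> sources S" "s' \<noteq> s"
      and a: "a \<in> body Q" "rel a \<in> rels S s'" "x \<in> set (args a)"
      using x by (auto simp: SJVars_def SVars_def source_atoms_def)
    have "rels S s' \<inter> rels S s = {}"
      using S s s' by (simp add: d_schema_def disjoint_family_on_def)
    then have "rel a \<notin> rels S s"
      using a(2) by blast
    \<comment> \<open>Outside \<open>s\<close> every value in a tuple has the form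
      \<open>g y\<close>. The second component of the match at \<open>x\<close> is \<open>x\<close>,
      which forces \<open>y = x\<close>, so the first component is \<open>h x\<close>.\<close>
    then obtain c :: "'r atom" where c: "map (k \<circ> \<beta>) (args a) = map g (args c)"
      using k\<beta>[OF a(1)] by (auto simp: E_def)
    have "(k \<circ> \<beta>) x \<in> set (map g (args c))"
      using a(3) by (simp flip: c)
    then obtain y where y: "k (\<beta> x) = g y" by auto
    moreover have "x \<in> vars Q"
      using a by (auto simp: vars_def)
    ultimately have "y = x"
      using inv[of x] by (simp add: fg)
    then show ?thesis
      by (simp add: j_def y fg)
  qed
  moreover have "set (head (CanV S s Q)) = SJVars S s Q"
    using free_vars_CanV_boolean[OF Q(2)] Q(1) by (simp add: free_vars_def cq_over_def)
  ultimately have "t = map j (head (CanV S s Q)) \<and>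
      (\<forall>a\<in>body (CanV S s Q). map j (args a) \<in> D' (rel a))"
    by (simp add: t) (simp add: CanV_def)
  then show "t \<in> cq_eval (CanV S s Q) D'"
    by (auto simp: cq_eval_def)
qed

theorem mainTheorem1:
  fixes S :: "('s, 'r) dschema"
    and V :: "('s, 'r, 'c) dview"
    and Q :: "'r cq"
  assumes "infinite (UNIV :: 'c set)"
    and "d_schema S"
    and "cq_over S (all_rels S) Q"
    and "boolean_cq Q"
    and "minimal_cq Q"
    and "d_view S V"
    and "cq_based S V"
    and "determines S V (cq_eval Q)"
  shows "\<forall>s\<in>sources S. determines S V (cq_eval (CanV S s Q))"
proof
  fix s assume s: "s \<in> sources S"
  note mono = cq_eval_CanV_mono[OF assms(1-5,7,8) s]
  show "determines S V (cq_eval (CanV S s Q))"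
    unfolding determines_def
  proof (intro allI impI)
    fix D D' :: "('r, 'c) inst"
    assume D: "d_instance S D" "d_instance S D'" "indistinguishable S V D D'"
    then have "indistinguishable S V D' D"
      by (metis indistinguishable_def)
    then show "cq_eval (CanV S s Q) D = cq_eval (CanV S s Q) D'"
      using mono D by blast
  qed
qed

end
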